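(* Let $k$ be an algebraically closed field of characteristic $0$ and let $a,b\in k$ satisfy $(4a^3+27-18ab-a^2b^2+4b^3)(b^3-27)\neq0$. Put $F=X^3+aX^2+bX+1$, $G=4X^3+b^2X^2+2bX+1$, let $K=k(X,Y)$ with $Y^2=F(X)G(X)$, and let $E_1,E_2$ be the degree $3$ elliptic subfields of $K$ described in the context. Put $u=ab$, $v=b^3$ and assume $v\ne 0,27$. Then the $j$-invariants $j_i$ of $E_i$ are $$j_1=16v\,\frac{(vu^2+216u^2-126vu-972u+12v^2+405v)^3}{(v-27)^3(4v^2+27v+4u^3-18vu-vu^2)^2},$$ $$j_2=-256\,\frac{(u^2-3v)^3}{v(4v^2+27v+4u^3-18vu-vu^2)} .$$
   Context: $E_1=k(U_1,V_1)$ with $U_1=X^2/F(X)$, $V_1=Y(X^3-bX-2)/F(X)^2$. $E_2=k(U_2,V_2)$ where: if $b(b^3-4ab+9)\neq0$, $U_2=(X-s)^2(X-t)/G(X)$ with $s=-3/b$, $t=(3a-b^2)/(b^3-4ab+9)$, and $V_2=\sqrt{27-b^3}\,Y\big((4ab-8-b^3)X^3-(b^2-4a)X^2+bX+1\big)/G(X)^2$; if $b^3-4ab+9=0$, $U_2=(bX+3)^2/(b^2G(X))$ and $V_2=\frac8b\sqrt b\,Y(bX^3+9X^2+b^2X+b)/G(X)^2$. Each $E_i$ has genus $1$ and $[K:E_i]=3$. The $j$-invariant is normalized so that $y^2=x^3+x$ has $j=1728$. *)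

theory Defs
  imports "HOL-Computational_Algebra.Computational_Algebra"
begin

text \<open>
  A field extension of \<open>k\<close> is given by a field \<open>'K\<close> and an embedding \<open>\<iota> : k \<rightarrow> 'K\<close>;
  intermediate fields are subsets of \<open>'K\<close>.
\<close>

definition field_embedding :: "('k::field \<Rightarrow> 'K::field) \<Rightarrow> bool" where
  "field_embedding \<iota> \<longleftrightarrow>
     \<iota> 1 = 1 \<and> (\<forall>x y. \<iota> (x + y) = \<iota> x + \<iota> y) \<and> (\<forall>x y. \<iota> (x * y) = \<iota> x * \<iota> y)"

definition transcendental_over :: "('k::field \<Rightarrow> 'K::field) \<Rightarrow> 'K \<Rightarrow> bool" where
  "transcendental_over \<iota> x \<longleftrightarrow> (\<forall>p. poly (map_poly \<iota> p) x = 0 \<longrightarrow> p = 0)"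

inductive_set field_adjoin :: "('k::field \<Rightarrow> 'K::field) \<Rightarrow> 'K set \<Rightarrow> 'K set"
  for \<iota> S where
    const: "\<iota> c \<in> field_adjoin \<iota> S"
  | gen: "x \<in> S \<Longrightarrow> x \<in> field_adjoin \<iota> S"
  | add: "x \<in> field_adjoin \<iota> S \<Longrightarrow> y \<in> field_adjoin \<iota> S \<Longrightarrow> x + y \<in> field_adjoin \<iota> S"
  | uminus: "x \<in> field_adjoin \<iota> S \<Longrightarrow> - x \<in> field_adjoin \<iota> S"
  | mult: "x \<in> field_adjoin \<iota> S \<Longrightarrow> y \<in> field_adjoin \<iota> S \<Longrightarrow> x * y \<in> field_adjoin \<iota> S"
  | inverse: "x \<in> field_adjoin \<iota> S \<Longrightarrow> inverse x \<in> field_adjoin \<iota> S"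

text \<open>
  \<open>E = k(x,y)\<close> with \<open>y\<^sup>2 = x\<^sup>3 + A x + B\<close> nonsingular. In characteristic 0 every elliptic
  function field over an algebraically closed \<open>k\<close> is of this form.
\<close>

definition weierstrass_model ::
    "('k::field \<Rightarrow> 'K::field) \<Rightarrow> 'K set \<Rightarrow> 'k \<Rightarrow> 'k \<Rightarrow> 'K \<Rightarrow> 'K \<Rightarrow> bool" where
  "weierstrass_model \<iota> E A B x y \<longleftrightarrow>
     transcendental_over \<iota> x \<and> y^2 = x^3 + \<iota> A * x + \<iota> B \<and>
     4 * A^3 + 27 * B^2 \<noteq> 0 \<and> E = field_adjoin \<iota> {x, y}"

definition weierstrass_j :: "'k::field \<Rightarrow> 'k \<Rightarrow> 'k" where
  "weierstrass_j A B = 1728 * (4 * A^3) / (4 * A^3 + 27 * B^2)"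

text \<open>
  The \<open>j\<close>-invariant of an elliptic function field is that of any of its Weierstrass models;
  the value is classically independent of the model.
\<close>

definition has_j_invariant :: "('k::field \<Rightarrow> 'K::field) \<Rightarrow> 'K set \<Rightarrow> 'k \<Rightarrow> bool" where
  "has_j_invariant \<iota> E j \<longleftrightarrow> (\<exists>A B x y. weierstrass_model \<iota> E A B x y \<and> j = weierstrass_j A B)"

text \<open>
  In the formulas below \<open>a\<close> and \<open>b\<close> are already elements of the field \<open>K\<close>, that is, images
  under \<open>\<iota>\<close>.
\<close>

definition F :: "'K::field \<Rightarrow> 'K \<Rightarrow> 'K \<Rightarrow> 'K" where
  "F a b X = X^3 + a * X^2 + b * X + 1"

definition G :: "'K::field \<Rightarrow> 'K \<Rightarrow> 'K" where
  "G b X = 4 * X^3 + b^2 * X^2 + 2 * b * X + 1"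

definition U1 :: "'K::field \<Rightarrow> 'K \<Rightarrow> 'K \<Rightarrow> 'K" where
  "U1 a b X = X^2 / F a b X"

definition V1 :: "'K::field \<Rightarrow> 'K \<Rightarrow> 'K \<Rightarrow> 'K \<Rightarrow> 'K" where
  "V1 a b X Y = Y * (X^3 - b * X - 2) / (F a b X)^2"

definition U2 :: "'K::field \<Rightarrow> 'K \<Rightarrow> 'K \<Rightarrow> 'K" where
  "U2 a b X =
     (if b^3 - 4 * a * b + 9 \<noteq> 0
      then let s = - 3 / b; t = (3 * a - b^2) / (b^3 - 4 * a * b + 9)
           in (X - s)^2 * (X - t) / G b X
      else (b * X + 3)^2 / (b^2 * G b X))"

text \<open>
  The parameters \<open>r\<close> and \<open>q\<close> stand for choices of the square roots of \<open>27 - b\<^sup>3\<close> and of \<open>b\<close>.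
\<close>

definition V2 :: "'K::field \<Rightarrow> 'K \<Rightarrow> 'K \<Rightarrow> 'K \<Rightarrow> 'K \<Rightarrow> 'K \<Rightarrow> 'K" where
  "V2 a b r q X Y =
     (if b^3 - 4 * a * b + 9 \<noteq> 0
      then r * Y * ((4 * a * b - 8 - b^3) * X^3 - (b^2 - 4 * a) * X^2 + b * X + 1) / (G b X)^2
      else 8 / b * q * Y * (b * X^3 + 9 * X^2 + b^2 * X + b) / (G b X)^2)"

definition E1 :: "('k::field \<Rightarrow> 'K::field) \<Rightarrow> 'k \<Rightarrow> 'k \<Rightarrow> 'K \<Rightarrow> 'K \<Rightarrow> 'K set" where
  "E1 \<iota> a b X Y = field_adjoin \<iota> {U1 (\<iota> a) (\<iota> b) X, V1 (\<iota> a) (\<iota> b) X Y}"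

text \<open>
  \<open>U2\<close>, \<open>V2\<close> and \<open>E2\<close> are meaningful only for \<open>b \<noteq> 0\<close>.
\<close>

definition E2 :: "('k::field \<Rightarrow> 'K::field) \<Rightarrow> 'k \<Rightarrow> 'k \<Rightarrow> 'k \<Rightarrow> 'k \<Rightarrow> 'K \<Rightarrow> 'K \<Rightarrow> 'K set" where
  "E2 \<iota> a b r q X Y =
     field_adjoin \<iota> {U2 (\<iota> a) (\<iota> b) X, V2 (\<iota> a) (\<iota> b) (\<iota> r) (\<iota> q) X Y}"

end

theory Submission
  imports Defs
begin

text \<open>
  The generators satisfy \<open>V\<^sup>2 = c\<^sub>3 U\<^sup>3 + c\<^sub>2 U\<^sup>2 + c\<^sub>1 U + c\<^sub>0\<close> with \<open>c\<^sub>i \<in> k\<close>, and the substitution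
  \<open>x = c\<^sub>3 U + c\<^sub>2/3\<close>, \<open>y = c\<^sub>3 V\<close> turns this into a Weierstrass equation without enlarging the field.
  As \<open>k\<close> is algebraically closed, \<open>U\<close> is transcendental as soon as it is not a constant.
  For \<open>E\<^sub>2\<close> the two cases of the definition are scalings of one pair of generators,
  \<open>(bX+3)\<^sup>2 ((b\<^sup>3-4ab+9)X - (3a-b\<^sup>2)) / G\<close> and
  \<open>(27-b\<^sup>3)\<^bsup>3/2\<^esup> Y ((4ab-8-b\<^sup>3)X\<^sup>3 - (b\<^sup>2-4a)X\<^sup>2 + bX + 1) / G\<^sup>2\<close>, whose cubic has coefficients
  polynomial in \<open>a\<close>, \<open>b\<close> and leading coefficient \<open>-1\<close>.
\<close>

section \<open>Field embeddings, evaluation of polynomials over k, and adjunction\<close>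

locale embedded_field =
  fixes \<iota> :: "'k::field \<Rightarrow> 'K::field"
  assumes embedding: "field_embedding \<iota>"
begin

lemma hom_one [simp]: "\<iota> 1 = 1"
  and hom_add [simp]: "\<iota> (x + y) = \<iota> x + \<iota> y"
  and hom_mult [simp]: "\<iota> (x * y) = \<iota> x * \<iota> y"
  using embedding by (auto simp: field_embedding_def)

lemma hom_zero [simp]: "\<iota> 0 = 0"
  using hom_add[of 0 0] by (metis add_cancel_right_left add_0)

lemma hom_uminus [simp]: "\<iota> (- x) = - \<iota> x"
  using hom_add[of x "- x"] by (simp add: eq_neg_iff_add_eq_0 add.commute del: hom_add)

lemma hom_diff [simp]: "\<iota> (x - y) = \<iota> x - \<iota> y"
  using hom_add[of x "- y"] by (simp del: hom_add)

lemma hom_power [simp]: "\<iota> (x ^ n) = \<iota> x ^ n"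
  by (induction n) auto

lemma hom_of_nat [simp]: "\<iota> (of_nat n) = of_nat n"
  by (induction n) auto

lemma hom_numeral [simp]: "\<iota> (numeral n) = numeral n"
  using hom_of_nat[of "numeral n"] by (simp del: hom_of_nat)

lemma hom_eq_0_iff [simp]: "\<iota> x = 0 \<longleftrightarrow> x = 0"
proof
  assume "\<iota> x = 0"
  then have "\<iota> (x * inverse x) = 0" by simp
  then show "x = 0" by (cases "x = 0") (auto simp del: hom_mult)
qed simp

lemma hom_inverse [simp]: "\<iota> (inverse x) = inverse (\<iota> x)"
proof (cases "x = 0")
  case False
  then have "\<iota> x * \<iota> (inverse x) = 1" by (metis hom_mult hom_one right_inverse)
  then show ?thesis using inverse_unique by metis
qed simp

lemma hom_divide [simp]: "\<iota> (x / y) = \<iota> x / \<iota> y"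
  by (simp add: divide_inverse)

lemma poly_map_hom_pCons [simp]:
  "poly (map_poly \<iota> (pCons c p)) x = \<iota> c + x * poly (map_poly \<iota> p) x"
  by (simp add: map_poly_pCons)

lemma poly_map_hom_add:
  "poly (map_poly \<iota> (p + q)) x = poly (map_poly \<iota> p) x + poly (map_poly \<iota> q) x"
  by (induction p q rule: poly_induct2) (simp_all add: algebra_simps)

lemma poly_map_hom_smult: "poly (map_poly \<iota> (smult c p)) x = \<iota> c * poly (map_poly \<iota> p) x"
  by (induction p) (simp_all add: algebra_simps)

lemma poly_map_hom_mult:
  "poly (map_poly \<iota> (p * q)) x = poly (map_poly \<iota> p) x * poly (map_poly \<iota> q) x"
  by (induction p) (simp_all add: poly_map_hom_add poly_map_hom_smult algebra_simps)

text \<open>Licenses comparing coefficients in X: it yields the nonvanishing of \<open>F\<close> and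
  \<open>G\<close> and the nonconstancy of \<open>U1\<close> and of the generator used for
  \<open>E2\<close>.\<close>

lemma transcendental_cubic:
  assumes "transcendental_over \<iota> x"
    and "\<iota> c\<^sub>3 * x^3 + \<iota> c\<^sub>2 * x^2 + \<iota> c\<^sub>1 * x + \<iota> c\<^sub>0 = 0"
  shows "c\<^sub>0 = 0" "c\<^sub>1 = 0" "c\<^sub>2 = 0" "c\<^sub>3 = 0"
proof -
  have "poly (map_poly \<iota> [:c\<^sub>0, c\<^sub>1, c\<^sub>2, c\<^sub>3:]) x = 0"
    using assms(2) by (simp add: algebra_simps power2_eq_square power3_eq_cube)
  then have "[:c\<^sub>0, c\<^sub>1, c\<^sub>2, c\<^sub>3:] = 0"
    using assms(1) unfolding transcendental_over_def by blast
  then show "c\<^sub>0 = 0" "c\<^sub>1 = 0" "c\<^sub>2 = 0" "c\<^sub>3 = 0" by auto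
qed

lemma field_adjoin_subset:
  assumes "S \<subseteq> field_adjoin \<iota> T"
  shows "field_adjoin \<iota> S \<subseteq> field_adjoin \<iota> T"
proof
  fix x assume "x \<in> field_adjoin \<iota> S"
  then show "x \<in> field_adjoin \<iota> T"
    by induction (use assms in \<open>auto intro: field_adjoin.intros\<close>)
qed

lemma field_adjoin_affine_le:
  "field_adjoin \<iota> {\<iota> m * x + \<iota> t, \<iota> n * y} \<subseteq> field_adjoin \<iota> {x, y}"
  by (rule field_adjoin_subset)
    (simp add: field_adjoin.add field_adjoin.mult field_adjoin.const field_adjoin.gen)

lemma field_adjoin_affine:
  assumes "m \<noteq> 0" "n \<noteq> 0"
  shows "field_adjoin \<iota> {\<iota> m * x + \<iota> t, \<iota> n * y} = field_adjoin \<iota> {x, y}"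
proof (rule antisym[OF field_adjoin_affine_le])
  \<comment> \<open>The inverse substitution has the same affine shape, so the inclusion already
    proved also gives the converse.\<close>
  have "x = \<iota> (inverse m) * (\<iota> m * x + \<iota> t) + \<iota> (- (inverse m * t))"
    and "y = \<iota> (inverse n) * (\<iota> n * y)"
    using assms by (simp_all add: field_simps)
  then show "field_adjoin \<iota> {x, y} \<subseteq> field_adjoin \<iota> {\<iota> m * x + \<iota> t, \<iota> n * y}"
    using field_adjoin_affine_le by metis
qed

end

section \<open>Algebraically closed constants: transcendence and Weierstrass models\<close>

locale embedded_alg_closed_field = embedded_field \<iota>
  for \<iota> :: "'k::{alg_closed_field, field_char_0} \<Rightarrow> 'K::field"
begin

text \<open>Induction on the degree: split off a root c in k; then either x is the image of c, or x
  is a root of the cofactor, whose degree is smaller.\<close>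

lemma algebraic_in_range:
  assumes "p \<noteq> 0" "poly (map_poly \<iota> p) x = 0"
  shows "\<exists>c. x = \<iota> c"
  using assms
proof (induction "degree p" arbitrary: p)
  case 0
  then obtain c where "p = [:c:]" by (metis degree_eq_zeroE)
  with 0 show ?case by simp
next
  case (Suc n)
  then obtain c where "poly p c = 0"
    using alg_closed_imp_poly_has_root[of p] by auto
  then obtain q where q: "p = [:- c, 1:] * q" by (metis dvdE poly_eq_0_iff_dvd)
  with Suc.prems have "q \<noteq> 0" by auto
  moreover have "n = degree q"
    using Suc.hyps(2) \<open>q \<noteq> 0\<close> unfolding q by (subst (asm) degree_mult_eq) auto
  moreover have "x = \<iota> c \<or> poly (map_poly \<iota> q) x = 0"
    using Suc.prems(2) unfolding q poly_map_hom_mult by simp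
  ultimately show ?case using Suc.hyps(1) by blast
qed

lemma transcendental_overI:
  assumes "\<And>c. x \<noteq> \<iota> c"
  shows "transcendental_over \<iota> x"
  unfolding transcendental_over_def using algebraic_in_range assms by blast

text \<open>\<open>\<Delta>\<close> is minus the discriminant of the cubic. Passing to the
  Weierstrass form multiplies it by \<open>c\<^sub>3^2\<close>, and
  \<open>3 * A = 3 * c\<^sub>1 * c\<^sub>3 - c\<^sub>2^2\<close> accounts for the numerator.\<close>

lemma has_j_invariant_cubic:
  fixes U V :: 'K and c\<^sub>0 c\<^sub>1 c\<^sub>2 c\<^sub>3 :: 'k
  defines "\<Delta> \<equiv> 27 * c\<^sub>0^2 * c\<^sub>3^2 + 4 * c\<^sub>1^3 * c\<^sub>3 + 4 * c\<^sub>0 * c\<^sub>2^3 - c\<^sub>1^2 * c\<^sub>2^2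
                  - 18 * c\<^sub>0 * c\<^sub>1 * c\<^sub>2 * c\<^sub>3"
  assumes U: "\<And>c. U \<noteq> \<iota> c"
    and V: "V^2 = \<iota> c\<^sub>3 * U^3 + \<iota> c\<^sub>2 * U^2 + \<iota> c\<^sub>1 * U + \<iota> c\<^sub>0"
    and nz: "c\<^sub>3 \<noteq> 0" "\<Delta> \<noteq> 0"
  shows "has_j_invariant \<iota> (field_adjoin \<iota> {U, V})
           (256 * (3 * c\<^sub>1 * c\<^sub>3 - c\<^sub>2^2)^3 / (c\<^sub>3^2 * \<Delta>))"
proof -
  \<comment> \<open>In terms of \<open>t\<close> the coefficients \<open>A\<close> and
    \<open>B\<close> are free of denominators, so only polynomial identities remain for
    \<open>algebra\<close>.\<close>
  define t where "t = c\<^sub>2 / 3"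
  then have t: "c\<^sub>2 = 3 * t" by (simp add: field_simps)
  define A where "A = c\<^sub>1 * c\<^sub>3 - 3 * t^2"
  define B where "B = 2 * t^3 - c\<^sub>1 * c\<^sub>3 * t + c\<^sub>0 * c\<^sub>3^2"
  define x where "x = \<iota> c\<^sub>3 * U + \<iota> t"
  define y where "y = \<iota> c\<^sub>3 * V"
  have disc: "4 * A^3 + 27 * B^2 = c\<^sub>3^2 * \<Delta>"
    unfolding A_def B_def \<Delta>_def t by algebra
  have "transcendental_over \<iota> x"
  proof (rule transcendental_overI)
    fix c
    have "U = \<iota> ((c - t) / c\<^sub>3)" if "x = \<iota> c"
      using nz that unfolding x_def by (simp add: field_simps)
    with U show "x \<noteq> \<iota> c" by blast
  qed
  moreover have "y^2 = x^3 + \<iota> A * x + \<iota> B"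
    using V unfolding x_def y_def A_def B_def t by simp algebra
  moreover have "field_adjoin \<iota> {U, V} = field_adjoin \<iota> {x, y}"
    unfolding x_def y_def using nz by (simp add: field_adjoin_affine)
  ultimately have "weierstrass_model \<iota> (field_adjoin \<iota> {U, V}) A B x y"
    using nz disc by (simp add: weierstrass_model_def)
  moreover have "1728 * (4 * A^3) = 256 * (3 * c\<^sub>1 * c\<^sub>3 - c\<^sub>2^2)^3"
    unfolding A_def t by algebra
  ultimately show ?thesis
    unfolding has_j_invariant_def weierstrass_j_def disc[symmetric] by metis
qed

end

section \<open>Cubic equations satisfied by the generators\<close>

text \<open>Since \<open>Y^2 = f * g\<close>, the left side is \<open>g * R^2 / f^3\<close>, and
  \<open>eq\<close> divided by \<open>f^3\<close> is the claim. For \<open>E1\<close> the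
  denominator \<open>f\<close> is \<open>F\<close>; for \<open>E2\<close> the roles of
  \<open>F\<close> and \<open>G\<close> are exchanged.\<close>

lemma cubic_model:
  fixes f :: "'a::field"
  assumes "f \<noteq> 0" "Y^2 = f * g"
    and eq: "g * R^2 = c\<^sub>3 * n^3 + c\<^sub>2 * n^2 * f + c\<^sub>1 * n * f^2 + c\<^sub>0 * f^3"
  shows "(Y * R / f^2)^2 = c\<^sub>3 * (n / f)^3 + c\<^sub>2 * (n / f)^2 + c\<^sub>1 * (n / f) + c\<^sub>0"
proof -
  have "(Y * R / f^2)^2 = (g * R^2) / f^3"
    using assms(1,2) by (simp add: power_mult_distrib power_divide field_simps eval_nat_numeral)
  also have "\<dots> = c\<^sub>3 * (n / f)^3 + c\<^sub>2 * (n / f)^2 + c\<^sub>1 * (n / f) + c\<^sub>0"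
    using assms(1) unfolding eq by (simp add: power_divide field_simps eval_nat_numeral)
  finally show ?thesis .
qed

lemma E1_cubic_identity:
  fixes a b X :: "'a::field"
  shows "G b X * (X^3 - b * X - 2)^2 =
    - (4 * a^3 + 27 - 18 * a * b - a^2 * b^2 + 4 * b^3) * (X^2)^3
    + (12 * a^2 - 2 * a * b^2 - 18 * b) * (X^2)^2 * F a b X
    + (b^2 - 12 * a) * X^2 * (F a b X)^2
    + 4 * (F a b X)^3"
  \<comment> \<open>the coefficients are found by comparing coefficients of \<open>1, X\<^sup>2, X\<^sup>4, X\<^sup>6\<close> successively\<close>
  unfolding F_def G_def by algebra

text \<open>No division by b or by \<open>b^3 - 4 * a * b + 9\<close> occurs, so the degenerate case
  is covered; there \<open>N\<close> is a constant times \<open>(b * X + 3)^2\<close>. The last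
  coefficient can be read off at the double zero X = -3/b of \<open>N\<close>: there
  \<open>G\<close> is 4(b^3 - 27)/b^3 and the squared factor is -8 \<open>F\<close>, which gives the
  cube of -b^3 \<open>F\<close>.\<close>

lemma E2_cubic_identity:
  fixes a b X :: "'a::field"
  defines "N \<equiv> (b * X + 3)^2 * ((b^3 - 4 * a * b + 9) * X - (3 * a - b^2))"
  shows "(27 - b^3)^3 * F a b X *
      ((4 * a * b - 8 - b^3) * X^3 - (b^2 - 4 * a) * X^2 + b * X + 1)^2 =
    - 1 * N^3
    + (27 * b^2 - 54 * a - a * b^3) * N^2 * G b X
    + (- 729 * b - 189 * b^4 - b^7 + 972 * a * b^2 + 18 * a * b^5 - 729 * a^2 - 54 * a^2 * b^3)
        * N * (G b X)^2
    + (27 - 9 * a * b + 2 * b^3)^3 * (G b X)^3"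
  unfolding N_def F_def G_def by algebra

section \<open>The j-invariant of \<open>E1\<close>\<close>

context embedded_alg_closed_field
begin

lemma F_nonzero: "transcendental_over \<iota> X \<Longrightarrow> F (\<iota> a) (\<iota> b) X \<noteq> 0"
  using transcendental_cubic(1)[of X 1 a b 1] by (auto simp: F_def)

lemma G_nonzero: "transcendental_over \<iota> X \<Longrightarrow> G (\<iota> b) X \<noteq> 0"
  using transcendental_cubic(1)[of X 4 "b^2" "2 * b" 1] by (auto simp: G_def)

text \<open>The discriminant of \<open>F\<close> is \<open>- d\<close> and that of \<open>G\<close>
  is \<open>16 * (v - 27)\<close>. The first is the leading coefficient of the cubic; the second
  governs its discriminant.\<close>

lemma has_j_invariant_E1:
  fixes a b :: 'k
  defines "u \<equiv> a * b" and "v \<equiv> b^3"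
    and "d \<equiv> 4 * a^3 + 27 - 18 * a * b - a^2 * b^2 + 4 * b^3"
  assumes X: "transcendental_over \<iota> X"
    and Y: "Y^2 = F (\<iota> a) (\<iota> b) X * G (\<iota> b) X"
    and nz: "d \<noteq> 0" "b \<noteq> 0" "v \<noteq> 27"
  shows "has_j_invariant \<iota> (E1 \<iota> a b X Y)
           (16 * v * (v * u^2 + 216 * u^2 - 126 * v * u - 972 * u + 12 * v^2 + 405 * v)^3 /
             ((v - 27)^3 * (v * d)^2))"
proof -
  define c\<^sub>2 where "c\<^sub>2 = 12 * a^2 - 2 * a * b^2 - 18 * b"
  define c\<^sub>1 where "c\<^sub>1 = b^2 - 12 * a"
  define P where "P = v * u^2 + 216 * u^2 - 126 * v * u - 972 * u + 12 * v^2 + 405 * v"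
  define \<Delta> where "\<Delta> = 27 * 4^2 * (- d)^2 + 4 * c\<^sub>1^3 * (- d) + 4 * 4 * c\<^sub>2^3 - c\<^sub>1^2 * c\<^sub>2^2
                  - 18 * 4 * c\<^sub>1 * c\<^sub>2 * (- d)"
  let ?U = "U1 (\<iota> a) (\<iota> b) X" and ?V = "V1 (\<iota> a) (\<iota> b) X Y"
  have \<Delta>: "\<Delta> = - 16 * (v - 27)^3"
    unfolding \<Delta>_def c\<^sub>1_def c\<^sub>2_def d_def v_def by algebra
  \<comment> \<open>The factor b turns the expression into a polynomial in \<open>u\<close> and
    \<open>v\<close>. After cubing it leaves \<open>b^3 = v\<close> in the denominator, which
    explains the factor \<open>v\<close> in the numerator over \<open>(v * d)^2\<close>.\<close>
  have P: "b * (3 * c\<^sub>1 * (- d) - c\<^sub>2^2) = - P"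
    unfolding P_def c\<^sub>1_def c\<^sub>2_def d_def u_def v_def by algebra
  have "?U \<noteq> \<iota> c" for c
  proof
    assume "?U = \<iota> c"
    then have "X^2 = \<iota> c * F (\<iota> a) (\<iota> b) X"
      using F_nonzero[OF X, of a b] by (simp add: U1_def field_simps)
    then have "\<iota> (- c) * X^3 + \<iota> (1 - c * a) * X^2 + \<iota> (- c * b) * X + \<iota> (- c) = 0"
      by (simp add: F_def algebra_simps)
    from transcendental_cubic(1,3)[OF X this] show False by simp
  qed
  moreover have "?V^2 = \<iota> (- d) * ?U^3 + \<iota> c\<^sub>2 * ?U^2 + \<iota> c\<^sub>1 * ?U + \<iota> 4"
    unfolding U1_def V1_def
    by (rule cubic_model[OF F_nonzero[OF X] Y])
      (use E1_cubic_identity[of "\<iota> b" X "\<iota> a"] in \<open>simp add: d_def c\<^sub>1_def c\<^sub>2_def\<close>)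
  ultimately have "has_j_invariant \<iota> (E1 \<iota> a b X Y)
      (256 * (3 * c\<^sub>1 * (- d) - c\<^sub>2^2)^3 / ((- d)^2 * \<Delta>))"
    unfolding E1_def \<Delta>_def
    by (rule has_j_invariant_cubic) (use nz \<Delta> in \<open>simp_all add: \<Delta>_def\<close>)
  also have "256 * (3 * c\<^sub>1 * (- d) - c\<^sub>2^2)^3 / ((- d)^2 * \<Delta>) =
      16 * v * P^3 / ((v - 27)^3 * (v * d)^2)"
  proof -
    have "3 * c\<^sub>1 * (- d) - c\<^sub>2^2 = - P / b"
      using P nz(2) by (simp add: field_simps)
    then have "256 * (3 * c\<^sub>1 * (- d) - c\<^sub>2^2)^3 / ((- d)^2 * \<Delta>)
        = 256 * (- P / b)^3 / ((- d)^2 * (- 16 * (v - 27)^3))"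
      unfolding \<Delta> by simp
    also have "\<dots> = 16 * P^3 / (v * d^2 * (v - 27)^3)"
      by (simp add: power_divide v_def)
    also have "\<dots> = 16 * v * P^3 / ((v - 27)^3 * (v * d)^2)"
      using nz by (simp add: v_def power2_eq_square)
    finally show ?thesis .
  qed
  finally show ?thesis unfolding P_def .
qed

section \<open>The j-invariant of \<open>E2\<close>\<close>

text \<open>In each case of the definition the new generators are nonzero constant multiples of
  \<open>U2\<close> and \<open>V2\<close>, so a single computation serves both.\<close>

lemma E2_rescaled:
  fixes a b r q :: 'k
  defines "w \<equiv> b^3 - 4 * a * b + 9"
  assumes nz: "b \<noteq> 0" "b^3 \<noteq> 27" and r: "r^2 = 27 - b^3" and q: "q^2 = b"
  shows "E2 \<iota> a b r q X Y = field_adjoin \<iota>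
    {(\<iota> b * X + 3)^2 * (\<iota> w * X - \<iota> (3 * a - b^2)) / G (\<iota> b) X,
     Y * (\<iota> ((27 - b^3) * r) * ((4 * \<iota> a * \<iota> b - 8 - \<iota> b^3) * X^3
       - (\<iota> b^2 - 4 * \<iota> a) * X^2 + \<iota> b * X + 1)) / (G (\<iota> b) X)^2}"
    (is "_ = field_adjoin \<iota> {?U, ?V}")
proof -
  have "\<exists>m n. m \<noteq> 0 \<and> n \<noteq> 0 \<and> ?U = \<iota> m * U2 (\<iota> a) (\<iota> b) X
          \<and> ?V = \<iota> n * V2 (\<iota> a) (\<iota> b) (\<iota> r) (\<iota> q) X Y"
  proof (cases "w = 0")
    case False
    have w: "\<iota> b^3 - 4 * \<iota> a * \<iota> b + 9 = \<iota> w" by (simp add: w_def)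
    have "?U = \<iota> (b^2 * w) * U2 (\<iota> a) (\<iota> b) X"
    proof -
      have s: "\<iota> b^2 * (X - - 3 / \<iota> b)^2 = (\<iota> b * X + 3)^2"
        using nz by (simp add: power_mult_distrib[symmetric] distrib_left)
      have t: "\<iota> w * (X - (3 * \<iota> a - \<iota> b^2) / \<iota> w) = \<iota> w * X - \<iota> (3 * a - b^2)"
        using False by (simp add: field_simps)
      have "(\<iota> b * X + 3)^2 * (\<iota> w * X - \<iota> (3 * a - b^2)) = \<iota> (b^2 * w) *
          ((X - - 3 / \<iota> b)^2 * (X - (3 * \<iota> a - \<iota> b^2) / \<iota> w))"
        unfolding s[symmetric] t[symmetric] by (simp only: hom_mult hom_power mult_ac)
      then show ?thesis
        using False unfolding U2_def Let_def w by (simp del: hom_mult)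
    qed
    moreover have "?V = \<iota> (27 - b^3) * V2 (\<iota> a) (\<iota> b) (\<iota> r) (\<iota> q) X Y"
      using False unfolding V2_def w by (simp add: mult_ac)
    moreover have "b^2 * w \<noteq> 0" "27 - b^3 \<noteq> 0" using False nz by auto
    ultimately show ?thesis by blast
  next
    case True
    then have w: "\<iota> b^3 - 4 * \<iota> a * \<iota> b + 9 = 0"
      unfolding w_def by (metis hom_add hom_diff hom_mult hom_numeral hom_power hom_zero)
    \<comment> \<open>With \<open>w = 0\<close> the linear factor collapses to the constant
      \<open>- (3 * a - b^2)\<close>. \<open>X\<close> is arbitrary here, so \<open>G\<close> may
      vanish; then both sides are 0 by the convention for division by 0.\<close>
    have "?U = \<iota> (- (b^2 * (3 * a - b^2))) * U2 (\<iota> a) (\<iota> b) X"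
      using w True nz unfolding U2_def
      by (cases "G (\<iota> b) X = 0") (simp_all add: field_simps power2_eq_square)
    \<comment> \<open>This makes the scaling constant nonzero, as
      \<open>b^3 \<noteq> 27\<close>.\<close>
    moreover have "4 * b * (3 * a - b^2) = 27 - b^3"
      using True unfolding w_def by algebra
    then have "- (b^2 * (3 * a - b^2)) \<noteq> 0"
      using nz by auto
    moreover have "?V = \<iota> ((27 - b^3) * r / (8 * q)) * V2 (\<iota> a) (\<iota> b) (\<iota> r) (\<iota> q) X Y"
    proof -
      define T where "T = \<iota> b * X^3 + 9 * X^2 + \<iota> b^2 * X + \<iota> b"
      have nz': "\<iota> q \<noteq> 0" "\<iota> b \<noteq> 0" using q nz by auto
      \<comment> \<open>\<open>'K\<close> is only known to be a field; its characteristic is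
        controlled through the embedding of k.\<close>
      have "(8::'K) \<noteq> 0" using hom_eq_0_iff[of 8] by (simp del: hom_eq_0_iff)
      have "\<iota> b * ((4 * \<iota> a * \<iota> b - 8 - \<iota> b^3) * X^3
            - (\<iota> b^2 - 4 * \<iota> a) * X^2 + \<iota> b * X + 1) = T"
        using w unfolding T_def by algebra
      then have T: "(4 * \<iota> a * \<iota> b - 8 - \<iota> b^3) * X^3
            - (\<iota> b^2 - 4 * \<iota> a) * X^2 + \<iota> b * X + 1 = T / \<iota> b"
        using nz' by (metis nonzero_mult_div_cancel_left)
      show ?thesis
        using w nz' \<open>8 \<noteq> 0\<close> unfolding V2_def T T_def[symmetric]
        by (simp add: mult_ac del: right_diff_distrib_numeral left_diff_distrib_numeral)
    qed
    moreover have "(27 - b^3) * r / (8 * q) \<noteq> 0" using r q nz by auto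
    ultimately show ?thesis by blast
  qed
  then obtain m n where "m \<noteq> 0" "n \<noteq> 0" "?U = \<iota> m * U2 (\<iota> a) (\<iota> b) X"
    "?V = \<iota> n * V2 (\<iota> a) (\<iota> b) (\<iota> r) (\<iota> q) X Y"
    by blast
  then show ?thesis
    unfolding E2_def using field_adjoin_affine[of m n _ 0] by simp
qed

lemma has_j_invariant_E2:
  fixes a b r q :: 'k
  defines "u \<equiv> a * b" and "v \<equiv> b^3"
    and "d \<equiv> 4 * a^3 + 27 - 18 * a * b - a^2 * b^2 + 4 * b^3"
  assumes X: "transcendental_over \<iota> X"
    and Y: "Y^2 = F (\<iota> a) (\<iota> b) X * G (\<iota> b) X"
    and nz: "d \<noteq> 0" "b \<noteq> 0" "v \<noteq> 27"
    and r: "r^2 = 27 - b^3" and q: "q^2 = b"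
  shows "has_j_invariant \<iota> (E2 \<iota> a b r q X Y) (- 256 * (u^2 - 3 * v)^3 / (v * (v * d)))"
proof -
  define w where "w = b^3 - 4 * a * b + 9"
  define c\<^sub>2 where "c\<^sub>2 = 27 * b^2 - 54 * a - a * b^3"
  define c\<^sub>1 where "c\<^sub>1 = - 729 * b - 189 * b^4 - b^7 + 972 * a * b^2 + 18 * a * b^5
      - 729 * a^2 - 54 * a^2 * b^3"
  define c\<^sub>0 where "c\<^sub>0 = (27 - 9 * a * b + 2 * b^3)^3"
  define \<Delta> where "\<Delta> = 27 * c\<^sub>0^2 * (- 1)^2 + 4 * c\<^sub>1^3 * (- 1) + 4 * c\<^sub>0 * c\<^sub>2^3 - c\<^sub>1^2 * c\<^sub>2^2
                  - 18 * c\<^sub>0 * c\<^sub>1 * c\<^sub>2 * (- 1)"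
  define N where "N = (\<iota> b * X + 3)^2 * (\<iota> w * X - \<iota> (3 * a - b^2))"
  define Q where "Q = (4 * \<iota> a * \<iota> b - 8 - \<iota> b^3) * X^3
       - (\<iota> b^2 - 4 * \<iota> a) * X^2 + \<iota> b * X + 1"
  let ?U = "N / G (\<iota> b) X" and ?V = "Y * (\<iota> ((27 - b^3) * r) * Q) / (G (\<iota> b) X)^2"
  have \<Delta>: "\<Delta> = (v - 27)^6 * d"
    unfolding \<Delta>_def c\<^sub>0_def c\<^sub>1_def c\<^sub>2_def d_def v_def by algebra
  \<comment> \<open>The cube of \<open>(v - 27)^2\<close> will cancel the sixth power in
    \<open>\<Delta>\<close>, and the cube of \<open>b^2\<close> becomes the \<open>v^2\<close> of
    the denominator.\<close>
  have P: "b^2 * (3 * c\<^sub>1 * (- 1) - c\<^sub>2^2) = - (u^2 - 3 * v) * (v - 27)^2"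
    unfolding c\<^sub>1_def c\<^sub>2_def u_def v_def by algebra
  have "?U \<noteq> \<iota> c" for c
  proof
    assume "?U = \<iota> c"
    then have "N = \<iota> c * G (\<iota> b) X"
      using G_nonzero[OF X, of b] by (simp add: field_simps)
    then have "\<iota> (b^2 * w - 4 * c) * X^3 + \<iota> (6 * b * w - b^2 * (3 * a - b^2) - c * b^2) * X^2
        + \<iota> (9 * w - 6 * b * (3 * a - b^2) - 2 * b * c) * X + \<iota> (- 9 * (3 * a - b^2) - c) = 0"
      unfolding N_def G_def by simp algebra
    from transcendental_cubic[OF X this]
    \<comment> \<open>A constant quotient means that \<open>N\<close> is \<open>c\<close> times
      \<open>G\<close>. Eliminating between coefficients forces \<open>c = 0\<close>, hence
      \<open>w = 0\<close> and \<open>3 * a = b^2\<close>; this contradicts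
      \<open>v \<noteq> 27\<close> because
      \<open>27 - b^3 = 4 * b * (3 * a - b^2) + 3 * w\<close>.\<close>
    have "(b^3 - 27) * c = 0" "b^2 * w = 4 * c" "c = - 9 * (3 * a - b^2)"
      unfolding w_def by (algebra, algebra, algebra)
    then have "w = 0" "3 * a - b^2 = 0" using nz by (auto simp: v_def)
    then have "b^3 - 27 = 0" unfolding w_def by algebra
    with nz show False by (simp add: v_def)
  qed
  moreover have "?V^2 = \<iota> (- 1) * ?U^3 + \<iota> c\<^sub>2 * ?U^2 + \<iota> c\<^sub>1 * ?U + \<iota> c\<^sub>0"
  proof (rule cubic_model[OF G_nonzero[OF X]])
    show "Y^2 = G (\<iota> b) X * F (\<iota> a) (\<iota> b) X" using Y by (simp add: mult.commute)
    have "\<iota> ((27 - b^3) * r)^2 = (27 - \<iota> b^3)^3"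
    proof -
      have "((27 - b^3) * r)^2 = (27 - b^3)^3"
        using r by (simp add: power_mult_distrib eval_nat_numeral)
      then show ?thesis by (metis hom_diff hom_numeral hom_power)
    qed
    then have "F (\<iota> a) (\<iota> b) X * (\<iota> ((27 - b^3) * r) * Q)^2
        = (27 - \<iota> b^3)^3 * F (\<iota> a) (\<iota> b) X * Q^2"
      by (simp only: power_mult_distrib mult_ac)
    also have "\<dots> = \<iota> (- 1) * N^3 + \<iota> c\<^sub>2 * N^2 * G (\<iota> b) X + \<iota> c\<^sub>1 * N * (G (\<iota> b) X)^2
        + \<iota> c\<^sub>0 * (G (\<iota> b) X)^3"
      using E2_cubic_identity[of "\<iota> b" "\<iota> a" X]
      by (simp add: N_def Q_def w_def c\<^sub>0_def c\<^sub>1_def c\<^sub>2_def)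
    finally show "F (\<iota> a) (\<iota> b) X * (\<iota> ((27 - b^3) * r) * Q)^2 = \<dots>" .
  qed
  ultimately have "has_j_invariant \<iota> (field_adjoin \<iota> {?U, ?V})
      (256 * (3 * c\<^sub>1 * (- 1) - c\<^sub>2^2)^3 / ((- 1)^2 * \<Delta>))"
    unfolding \<Delta>_def
    by (rule has_j_invariant_cubic) (use nz \<Delta> in \<open>simp_all add: \<Delta>_def\<close>)
  moreover have "E2 \<iota> a b r q X Y = field_adjoin \<iota> {?U, ?V}"
    using E2_rescaled nz r q unfolding N_def Q_def w_def v_def by blast
  moreover have "256 * (3 * c\<^sub>1 * (- 1) - c\<^sub>2^2)^3 / ((- 1)^2 * \<Delta>)
      = - 256 * (u^2 - 3 * v)^3 / (v * (v * d))"
  proof -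
    have "3 * c\<^sub>1 * (- 1) - c\<^sub>2^2 = - ((u^2 - 3 * v) * (v - 27)^2 / b^2)"
      using P nz(2) by (simp add: field_simps)
    then have "256 * (3 * c\<^sub>1 * (- 1) - c\<^sub>2^2)^3 / ((- 1)^2 * \<Delta>)
        = 256 * (- ((u^2 - 3 * v) * (v - 27)^2 / b^2))^3 / ((v - 27)^6 * d)"
      unfolding \<Delta> by simp
    also have "\<dots> = - 256 * (u^2 - 3 * v)^3 * (v - 27)^6 / (b^6 * ((v - 27)^6 * d))"
      by (simp add: power_divide power_mult_distrib flip: power_mult)
    also have "\<dots> = - 256 * (u^2 - 3 * v)^3 / (v * (v * d))"
      using nz(3) by (simp add: v_def flip: power_add mult.assoc)
    finally show ?thesis .
  qed
  ultimately show ?thesis by simp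
qed

end

theorem mainTheorem9:
  fixes \<iota> :: "'k::{alg_closed_field, field_char_0} \<Rightarrow> 'K::field"
    and a b u v r q :: 'k
    and X Y :: 'K
  assumes "field_embedding \<iota>"
    and "transcendental_over \<iota> X"
    and "Y^2 = F (\<iota> a) (\<iota> b) X * G (\<iota> b) X"
    and "field_adjoin \<iota> {X, Y} = UNIV"
    and "(4 * a^3 + 27 - 18 * a * b - a^2 * b^2 + 4 * b^3) * (b^3 - 27) \<noteq> 0"
    and "u = a * b" and "v = b^3"
    and "v \<noteq> 0" and "v \<noteq> 27"
    and "r^2 = 27 - b^3" and "q^2 = b"
  shows "has_j_invariant \<iota> (E1 \<iota> a b X Y)
           (16 * v * (v * u^2 + 216 * u^2 - 126 * v * u - 972 * u + 12 * v^2 + 405 * v)^3 /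
             ((v - 27)^3 * (4 * v^2 + 27 * v + 4 * u^3 - 18 * v * u - v * u^2)^2)) \<and>
         has_j_invariant \<iota> (E2 \<iota> a b r q X Y)
           (- 256 * (u^2 - 3 * v)^3 /
             (v * (4 * v^2 + 27 * v + 4 * u^3 - 18 * v * u - v * u^2)))"
proof -
  interpret embedded_alg_closed_field \<iota>
    by unfold_locales fact
  \<comment> \<open>Both stated denominators contain \<open>v\<close> times minus the discriminant
    of \<open>F\<close>, here rewritten in \<open>u\<close> and \<open>v\<close>.\<close>
  have "4 * v^2 + 27 * v + 4 * u^3 - 18 * v * u - v * u^2 =
      v * (4 * a^3 + 27 - 18 * a * b - a^2 * b^2 + 4 * b^3)"
    using assms(6,7) by algebra
  then show ?thesis
    using has_j_invariant_E1[of X Y a b] has_j_invariant_E2[of X Y a b r q] assms by auto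
qed

end
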